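(* For every semiring $\mathbb{S}$ with commuting and small idempotents and every $n\ge 2$, the monoid $ET_n(\mathbb{S})$ is equationally equivalent to the monoid $T_n(\mathbb{B})$ of all $n\times n$ triangular Boolean matrices.
   Context: A semiring here is $\mathbb{S}=(S,+,\cdot)$ such that: (S1) $(S,+)$ is a commutative semigroup; (S2) $(S,\cdot)$ is a semigroup; (S3) both distributive laws hold; (S4) there is an element $0$ with $0+a=a+0=a$ and $a\cdot 0=0\cdot a=0$ for all $a\in S$; (S5) there is an element $1\neq 0$ with $a\cdot 1=1\cdot a=a$ for all $a\in S$. (Multiplication need not be commutative.) $\mathbb{B}=(\{0,1\},+,\cdot)$ is the Boolean semiring, in which $1+1=1$. A semiring with commuting and small idempotents is a semiring that is additively idempotent ($a+a=a$ for all $a$), whose multiplicative idempotents commute ($e=e^2$ and $f=f^2$ imply $ef=fe$), and which has small idempotents: $e=e^2$ implies $e+1=1$ (i.e. $e\le 1$ in the order $a\le b\Leftrightarrow a+b=b$). An $n\times n$ matrix $(\alpha_{ij})$ over $\mathbb{S}$ is triangular if $\alpha_{ij}=0$ whenever $j<i$. $T_n(\mathbb{S})$ is the monoid of all $n\times n$ triangular matrices over $\mathbb{S}$ under matrix multiplication. $ET_n(\mathbb{S})$ is its submonoid of all matrices with multiplicatively idempotent diagonal entries, $\alpha_{ii}^2=\alpha_{ii}$ for $i=1,\dots,n$. Monoids are considered as semigroups (only binary multiplication in the signature). A semigroup identity is a pair $\mathbf{u}\approx\mathbf{v}$ of words in the free semigroup $\mathcal{X}^+$ on a countably infinite set $\mathcal{X}$;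 it holds in a semigroup $S$ if $\varphi(\mathbf{u})=\varphi(\mathbf{v})$ for every morphism $\varphi:\mathcal{X}^+\to S$. Two semigroups are equationally equivalent if they satisfy the same semigroup identities. *)

theory Defs
  imports "Jordan_Normal_Form.Matrix"
begin

section \<open>Semirings with commuting and small idempotents\<close>

text \<open>The class \<^class>\<open>semiring_1\<close> supplies the semiring axioms: additive commutativity, both
  distributive laws, an absorbing zero and a unit \<open>1 \<noteq> 0\<close>; multiplication need not commute.
  In the order \<open>a \<le> b \<longleftrightarrow> a + b = b\<close>, smallness of idempotents reads \<open>e \<le> 1\<close>.\<close>

class comm_small_idem_semiring = semiring_1 +
  assumes add_idem: "a + a = a"
    and mult_idem_commute: "e * e = e \<Longrightarrow> f * f = f \<Longrightarrow> e * f = f * e"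
    and mult_idem_small: "e * e = e \<Longrightarrow> e + 1 = 1"

section \<open>The Boolean semiring\<close>

datatype boolean = BZero | BOne

instantiation boolean :: comm_small_idem_semiring
begin

definition zero_boolean :: boolean where "0 = BZero"

definition one_boolean :: boolean where "1 = BOne"

fun plus_boolean :: "boolean \<Rightarrow> boolean \<Rightarrow> boolean" where
  "BZero + b = b"
| "BOne + b = BOne"

fun times_boolean :: "boolean \<Rightarrow> boolean \<Rightarrow> boolean" where
  "BZero * b = BZero"
| "BOne * b = b"

instance
proof
  fix a b c :: boolean
  show "a + b + c = a + (b + c)" by (cases a) simp_all
  show "a + b = b + a" by (cases a; cases b) simp_all
  show "0 + a = a" by (simp add: zero_boolean_def)
  show "a * b * c = a * (b * c)" by (cases a) simp_all
  show "1 * a = a" by (simp add: one_boolean_def)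
  show "a * 1 = a" by (cases a) (simp_all add: one_boolean_def)
  show "(a + b) * c = a * c + b * c" by (cases a; cases b; cases c) simp_all
  show "a * (b + c) = a * b + a * c" by (cases a) simp_all
  show "0 * a = 0" by (simp add: zero_boolean_def)
  show "a * 0 = 0" by (cases a) (simp_all add: zero_boolean_def)
  show "(0::boolean) \<noteq> 1" by (simp add: zero_boolean_def one_boolean_def)
  show "a + a = a" by (cases a) simp_all
  show "a * b = b * a" by (cases a; cases b) simp_all
  show "a + 1 = 1" by (cases a) (simp_all add: one_boolean_def)
qed

end

section \<open>Monoids of triangular matrices\<close>

definition triangular_monoid :: "nat \<Rightarrow> 'a::semiring_1 mat monoid" where
  "triangular_monoid n =
    \<lparr>carrier = {A \<in> carrier_mat n n. upper_triangular A}, mult = (*), one = 1\<^sub>m n\<rparr>"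

definition idem_diag_triangular_monoid :: "nat \<Rightarrow> 'a::semiring_1 mat monoid" where
  "idem_diag_triangular_monoid n =
    \<lparr>carrier = {A \<in> carrier_mat n n. upper_triangular A \<and>
                 (\<forall>i<n. A $$ (i, i) * A $$ (i, i) = A $$ (i, i))},
     mult = (*), one = 1\<^sub>m n\<rparr>"

lemma index_mult_triangular:
  fixes A B :: "'a::semiring_1 mat"
  assumes "A \<in> carrier_mat n n" "B \<in> carrier_mat n n"
    and "upper_triangular A" "upper_triangular B" "j \<le> i" "i < n"
  shows "(A * B) $$ (i, j) = (if i = j then A $$ (i, i) * B $$ (i, i) else 0)"
proof -
  have eq: "(A * B) $$ (i, j) = (\<Sum>k\<in>{0..<n}. A $$ (i, k) * B $$ (k, j))"
    using assms by (auto simp: scalar_prod_def intro!: sum.cong)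
  have zero: "A $$ (i, k) * B $$ (k, j) = 0" if "k < n" "k \<noteq> i \<or> i \<noteq> j" for k
  proof (cases "k < i")
    case True
    then have "A $$ (i, k) = 0" using assms by auto
    then show ?thesis by simp
  next
    case False
    then have "B $$ (k, j) = 0" using that assms by auto
    then show ?thesis by simp
  qed
  show ?thesis
  proof (cases "i = j")
    case True
    have "(\<Sum>k\<in>{0..<n}. A $$ (i, k) * B $$ (k, j))
        = (\<Sum>k\<in>{0..<n}. if k = i then A $$ (i, i) * B $$ (i, i) else 0)"
      by (rule sum.cong) (use True zero in auto)
    also have "\<dots> = A $$ (i, i) * B $$ (i, i)" using assms by simp
    finally show ?thesis using eq True by simp
  next
    case False
    then show ?thesis using eq zero by simp
  qed
qed

lemma upper_triangular_mult:
  fixes A B :: "'a::semiring_1 mat"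
  assumes "A \<in> carrier_mat n n" "B \<in> carrier_mat n n" "upper_triangular A" "upper_triangular B"
  shows "upper_triangular (A * B)"
proof (rule upper_triangularI)
  fix i j assume "j < i" "i < dim_row (A * B)"
  then show "(A * B) $$ (i, j) = 0"
    using index_mult_triangular[OF assms, of j i] assms by simp
qed

lemma monoid_triangular_monoid: "monoid (triangular_monoid n :: 'a::semiring_1 mat monoid)"
  by (rule monoidI) (auto simp: triangular_monoid_def intro: upper_triangular_mult)

lemma monoid_idem_diag_triangular_monoid:
  "monoid (idem_diag_triangular_monoid n :: 'a::comm_small_idem_semiring mat monoid)"
proof -
  have idem: "(e * f) * (e * f) = e * f" if "e * e = e" "f * f = f" for e f :: 'a
  proof -
    have "(e * f) * (e * f) = e * (f * e) * f" by (simp add: mult.assoc)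
    also have "\<dots> = (e * e) * (f * f)"
      by (simp only: mult_idem_commute[OF that(2) that(1)] mult.assoc)
    finally show ?thesis using that by simp
  qed
  show ?thesis
    by (rule monoidI)
      (auto simp: idem_diag_triangular_monoid_def index_mult_triangular idem
        simp del: index_mult_mat(1) intro: upper_triangular_mult)
qed

section \<open>Semigroup identities\<close>

text \<open>Words over the countably infinite alphabet \<^typ>\<open>nat\<close>.\<close>

definition free_words :: "nat list set" where
  "free_words = {w. w \<noteq> []}"

text \<open>The field \<open>one\<close> of the target is not mentioned: monoids are treated as semigroups.\<close>

definition word_morphisms :: "('a, 'b) monoid_scheme \<Rightarrow> (nat list \<Rightarrow> 'a) set" where
  "word_morphisms M = {\<phi>. \<phi> \<in> free_words \<rightarrow> carrier M \<and>
    (\<forall>u\<in>free_words. \<forall>v\<in>free_words. \<phi> (u @ v) = \<phi> u \<otimes>\<^bsub>M\<^esub> \<phi> v)}"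

definition satisfies_identity ::
    "('a, 'b) monoid_scheme \<Rightarrow> nat list \<Rightarrow> nat list \<Rightarrow> bool" where
  "satisfies_identity M u v \<longleftrightarrow> (\<forall>\<phi>\<in>word_morphisms M. \<phi> u = \<phi> v)"

definition equationally_equivalent ::
    "('a, 'c) monoid_scheme \<Rightarrow> ('b, 'd) monoid_scheme \<Rightarrow> bool" where
  "equationally_equivalent M N \<longleftrightarrow>
    (\<forall>u\<in>free_words. \<forall>v\<in>free_words. satisfies_identity M u v \<longleftrightarrow> satisfies_identity N u v)"

end

theory Submission
  imports Defs
begin

text \<open>An entry of a product of triangular matrices is a sum over strictly increasing paths of states
  and factorizations \<open>w = w\<^sub>0 x\<^sub>1 w\<^sub>1 \<dots> x\<^sub>k w\<^sub>k\<close>, where the factor \<open>w\<^sub>r\<close> contributes a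
  product of commuting diagonal idempotents and hence depends only on its content. By smallness, the
  term can only grow when the content shrinks. So the entry depends only on which of the languages
  \<open>C\<^sub>0\<^sup>* x\<^sub>1 C\<^sub>1\<^sup>* \<dots> x\<^sub>k C\<^sub>k\<^sup>*\<close> with \<open>k < n\<close> contain \<open>w\<close>, and each of these is recognized by
  triangular Boolean \<open>n \<times> n\<close> matrices. Conversely, the Boolean semiring embeds in every
  additively idempotent one.\<close>

section \<open>Values of words\<close>

text \<open>The empty word gets the value \<open>one\<close> so that inductions can start there,
  although identities concern nonempty words only.\<close>

primrec word_value :: "('a, 'b) monoid_scheme \<Rightarrow> (nat \<Rightarrow> 'a) \<Rightarrow> nat list \<Rightarrow> 'a" where
  "word_value G f [] = \<one>\<^bsub>G\<^esub>"
| "word_value G f (x # w) = f x \<otimes>\<^bsub>G\<^esub> word_value G f w"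

lemma word_value_closed:
  assumes "monoid G" "range f \<subseteq> carrier G"
  shows "word_value G f w \<in> carrier G"
  using assms by (induction w) (auto intro: monoid.m_closed)

lemma word_value_append:
  assumes "monoid G" "range f \<subseteq> carrier G"
  shows "word_value G f (u @ v) = word_value G f u \<otimes>\<^bsub>G\<^esub> word_value G f v"
proof (induction u)
  case Nil
  show ?case using assms by (simp add: word_value_closed monoid.l_one)
next
  case (Cons x u)
  have "f x \<in> carrier G" using assms by blast
  with Cons show ?case using assms by (simp add: monoid.m_assoc word_value_closed)
qed

lemma word_value_in_word_morphisms:
  assumes "monoid G" "range f \<subseteq> carrier G"
  shows "word_value G f \<in> word_morphisms G"
  using assms by (simp add: word_morphisms_def word_value_closed word_value_append)

lemma word_morphism_eq_word_value:
  assumes "monoid G" "\<phi> \<in> word_morphisms G" "w \<noteq> []"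
  shows "\<phi> w = word_value G (\<lambda>x. \<phi> [x]) w"
  using \<open>w \<noteq> []\<close>
proof (induction w rule: list_nonempty_induct)
  case (single x)
  have "\<phi> [x] \<in> carrier G" using assms(2) by (auto simp: word_morphisms_def free_words_def)
  then show ?case using assms(1) by (simp add: monoid.r_one)
next
  case (cons x w)
  have "\<phi> ([x] @ w) = \<phi> [x] \<otimes>\<^bsub>G\<^esub> \<phi> w"
    using assms(2) cons(1) unfolding word_morphisms_def free_words_def by blast
  then show ?case using cons by simp
qed

text \<open>A morphism on nonempty words is determined by its values on letters, and these can be
  chosen freely in the carrier. Identities can thus be tested on assignments.\<close>

lemma satisfies_identity_iff_word_value:
  assumes "monoid G" "u \<noteq> []" "v \<noteq> []"
  shows "satisfies_identity G u v \<longleftrightarrow>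
    (\<forall>f. range f \<subseteq> carrier G \<longrightarrow> word_value G f u = word_value G f v)"
proof
  assume "satisfies_identity G u v"
  then show "\<forall>f. range f \<subseteq> carrier G \<longrightarrow> word_value G f u = word_value G f v"
    using word_value_in_word_morphisms[OF assms(1)] by (auto simp: satisfies_identity_def)
next
  assume eq: "\<forall>f. range f \<subseteq> carrier G \<longrightarrow> word_value G f u = word_value G f v"
  show "satisfies_identity G u v"
    unfolding satisfies_identity_def
  proof
    fix \<phi> assume \<phi>: "\<phi> \<in> word_morphisms G"
    then have "range (\<lambda>x. \<phi> [x]) \<subseteq> carrier G"
      by (auto simp: word_morphisms_def free_words_def)
    then show "\<phi> u = \<phi> v"
      using eq word_morphism_eq_word_value[OF assms(1) \<phi> assms(2)]
        word_morphism_eq_word_value[OF assms(1) \<phi> assms(3)] by metis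
  qed
qed

lemma index_word_value_Cons:
  fixes f :: "nat \<Rightarrow> 'a::comm_small_idem_semiring mat"
  assumes "range f \<subseteq> carrier (idem_diag_triangular_monoid n)" "i < n" "j < n"
  shows "word_value (idem_diag_triangular_monoid n) f (x # w) $$ (i, j) =
    (\<Sum>k<n. f x $$ (i, k) * word_value (idem_diag_triangular_monoid n) f w $$ (k, j))"
proof -
  have "f x \<in> carrier_mat n n" using assms(1) by (auto simp: idem_diag_triangular_monoid_def)
  moreover have "word_value (idem_diag_triangular_monoid n) f w \<in> carrier_mat n n"
    using word_value_closed[OF monoid_idem_diag_triangular_monoid assms(1)]
    by (auto simp: idem_diag_triangular_monoid_def)
  ultimately show ?thesis using assms(2,3)
    by (auto simp: idem_diag_triangular_monoid_def scalar_prod_def lessThan_atLeast0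
        intro!: sum.cong)
qed

text \<open>Both Boolean elements are idempotent. This makes the entry formula for idempotent
  diagonals available for Boolean matrices.\<close>

lemma idem_diag_triangular_monoid_boolean:
  "idem_diag_triangular_monoid n = (triangular_monoid n :: boolean mat monoid)"
proof -
  have "b * b = b" for b :: boolean by (cases b) simp_all
  then show ?thesis by (simp add: idem_diag_triangular_monoid_def triangular_monoid_def)
qed

section \<open>The natural order\<close>

definition nat_le :: "'a::comm_small_idem_semiring \<Rightarrow> 'a \<Rightarrow> bool" (infix "\<preceq>" 50) where
  "a \<preceq> b \<longleftrightarrow> a + b = b"

lemma nat_le_trans: "a \<preceq> b \<Longrightarrow> b \<preceq> c \<Longrightarrow> a \<preceq> c"
  unfolding nat_le_def by (metis add.assoc)

lemma nat_le_antisym: "a \<preceq> b \<Longrightarrow> b \<preceq> a \<Longrightarrow> a = b"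
  unfolding nat_le_def by (metis add.commute)

lemma nat_le_mult_left: "a \<preceq> b \<Longrightarrow> c * a \<preceq> c * b"
  by (simp add: nat_le_def flip: distrib_left)

lemma nat_le_mult_right: "a \<preceq> b \<Longrightarrow> a * c \<preceq> b * c"
  by (simp add: nat_le_def flip: distrib_right)

lemma nat_le_sum_member:
  assumes "finite A" "k \<in> A"
  shows "g k \<preceq> sum g A"
proof -
  have "sum g A = g k + sum g (A - {k})" using assms by (rule sum.remove)
  then show ?thesis by (simp add: nat_le_def add_idem flip: add.assoc)
qed

lemma sum_nat_le:
  assumes "\<And>k. k \<in> A \<Longrightarrow> g k \<preceq> b"
  shows "sum g A \<preceq> b"
  using assms by (induction A rule: infinite_finite_induct) (auto simp: nat_le_def add.assoc)

lemma idem_mult: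
  fixes e f :: "'a::comm_small_idem_semiring"
  assumes "e * e = e" "f * f = f"
  shows "(e * f) * (e * f) = e * f"
proof -
  have "(e * f) * (e * f) = e * (f * e) * f" by (simp add: mult.assoc)
  also have "\<dots> = (e * e) * (f * f)"
    by (simp only: mult_idem_commute[OF assms(2,1)] mult.assoc)
  finally show ?thesis by (simp add: assms)
qed

section \<open>Languages of factorizations\<close>

text \<open>A list \<open>[(x\<^sub>1, i\<^sub>1, C\<^sub>1), \<dots>, (x\<^sub>k, i\<^sub>k, C\<^sub>k)]\<close> together with \<open>C\<^sub>0\<close> encodes the language
  \<open>C\<^sub>0\<^sup>* x\<^sub>1 C\<^sub>1\<^sup>* \<dots> x\<^sub>k C\<^sub>k\<^sup>*\<close> and the path of states \<open>i\<^sub>1, \<dots>, i\<^sub>k\<close>; the states play no role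
  for membership. The contents \<open>C\<^sub>r\<close> are lists because multiplication
  need not commute.\<close>

type_synonym factor_path = "(nat \<times> nat \<times> nat list) list"

text \<open>A letter may lie in the current content and also be the next marked letter, so reading
  it is nondeterministic.\<close>

primrec in_lang :: "nat list \<Rightarrow> factor_path \<Rightarrow> nat list \<Rightarrow> bool" where
  "in_lang C l [] \<longleftrightarrow> l = []"
| "in_lang C l (y # w) \<longleftrightarrow> (y \<in> set C \<and> in_lang C l w) \<or>
     (\<exists>k C' l'. l = (y, k, C') # l' \<and> in_lang C' l' w)"

primrec is_path :: "nat \<Rightarrow> nat \<Rightarrow> factor_path \<Rightarrow> nat \<Rightarrow> bool" where
  "is_path n i [] j \<longleftrightarrow> i = j"
| "is_path n i (p # l) j \<longleftrightarrow> i < fst (snd p) \<and> fst (snd p) < n \<and> is_path n (fst (snd p)) l j"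

lemma in_lang_mono: "in_lang C l w \<Longrightarrow> set C \<subseteq> set C' \<Longrightarrow> in_lang C' l w"
  by (induction w arbitrary: l) auto

text \<open>The states increase strictly and stay below \<open>n\<close>; this is the source of the
  bound on the number of marked letters.\<close>

lemma length_is_path: "is_path n i l j \<Longrightarrow> i < n \<Longrightarrow> i + length l < n"
proof (induction l arbitrary: i)
  case (Cons p l)
  then have "fst (snd p) + length l < n" "i < fst (snd p)" by simp_all
  then show ?case by simp
qed simp

definition stay_value :: "(nat \<Rightarrow> 'a::semiring_1 mat) \<Rightarrow> nat \<Rightarrow> nat list \<Rightarrow> 'a" where
  "stay_value f i C = prod_list (map (\<lambda>x. f x $$ (i, i)) C)"

fun path_value :: "(nat \<Rightarrow> 'a::semiring_1 mat) \<Rightarrow> nat \<Rightarrow> nat list \<Rightarrow> factor_path \<Rightarrow> 'a" where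
  "path_value f i C [] = stay_value f i C"
| "path_value f i C ((x, k, C') # l) = stay_value f i C * (f x $$ (i, k) * path_value f k C' l)"

lemma path_value_Cons_content:
  "path_value f i (x # C) l = f x $$ (i, i) * path_value f i C l"
  by (cases l) (auto simp: stay_value_def mult.assoc)

context
  fixes n :: nat and f :: "nat \<Rightarrow> 'a::comm_small_idem_semiring mat"
  assumes f: "range f \<subseteq> carrier (idem_diag_triangular_monoid n)"
begin

lemma diag_idem: "i < n \<Longrightarrow> f x $$ (i, i) * f x $$ (i, i) = f x $$ (i, i)"
  using f by (auto simp: idem_diag_triangular_monoid_def)

lemma below_diag: "k < i \<Longrightarrow> i < n \<Longrightarrow> f x $$ (i, k) = 0"
proof -
  have "f x \<in> carrier (idem_diag_triangular_monoid n)" using f by blast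
  then show "k < i \<Longrightarrow> i < n \<Longrightarrow> f x $$ (i, k) = 0"
    by (auto simp: idem_diag_triangular_monoid_def)
qed

lemma stay_value_idem: "i < n \<Longrightarrow> stay_value f i C * stay_value f i C = stay_value f i C"
  by (induction C) (simp_all add: stay_value_def idem_mult diag_idem)

lemma stay_value_le_one: "i < n \<Longrightarrow> stay_value f i C \<preceq> 1"
  by (simp add: nat_le_def mult_idem_small stay_value_idem)

text \<open>The idempotent of \<open>x\<close> commutes past the other factors until it meets its
  own copy, which absorbs it.\<close>

lemma stay_value_absorb:
  assumes "i < n" "x \<in> set C"
  shows "f x $$ (i, i) * stay_value f i C = stay_value f i C"
  using assms(2)
proof (induction C)
  case (Cons y C)
  let ?d = "\<lambda>x. f x $$ (i, i)"
  show ?case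
  proof (cases "x = y")
    case True
    then show ?thesis by (simp add: stay_value_def diag_idem assms(1) flip: mult.assoc)
  next
    case False
    have "?d x * ?d y = ?d y * ?d x"
      by (intro mult_idem_commute diag_idem assms(1))
    then have "?d x * (?d y * stay_value f i C) = ?d y * (?d x * stay_value f i C)"
      by (simp flip: mult.assoc)
    with False Cons show ?thesis by (simp add: stay_value_def)
  qed
qed simp

lemma path_value_absorb:
  assumes "i < n" "x \<in> set C"
  shows "f x $$ (i, i) * path_value f i C l = path_value f i C l"
  by (cases l) (auto simp: stay_value_absorb assms simp flip: mult.assoc)

lemma path_value_le_word_value:
  assumes "in_lang C l w" "is_path n i l j" "i < n" "j < n"
  shows "path_value f i C l \<preceq> word_value (idem_diag_triangular_monoid n) f w $$ (i, j)"
  using assms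
proof (induction w arbitrary: i C l)
  case Nil
  then show ?case by (simp add: stay_value_le_one idem_diag_triangular_monoid_def)
next
  case (Cons y w)
  let ?W = "word_value (idem_diag_triangular_monoid n) f"
  have le: "f y $$ (i, k) * ?W w $$ (k, j) \<preceq> ?W (y # w) $$ (i, j)" if "k < n" for k
    unfolding index_word_value_Cons[OF f \<open>i < n\<close> \<open>j < n\<close>]
    using that nat_le_sum_member[of "{..<n}" k "\<lambda>k. f y $$ (i, k) * ?W w $$ (k, j)"] by simp
  from Cons.prems(1) consider "y \<in> set C" "in_lang C l w"
    | k C' l' where "l = (y, k, C') # l'" "in_lang C' l' w" by auto
  then show ?case
  proof cases
    case 1
    have "f y $$ (i, i) * path_value f i C l \<preceq> f y $$ (i, i) * ?W w $$ (i, j)"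
      by (intro nat_le_mult_left Cons.IH 1 Cons.prems)
    then show ?thesis
      using nat_le_trans[OF _ le[OF \<open>i < n\<close>]] path_value_absorb[OF \<open>i < n\<close> 1(1)]
      by (simp del: word_value.simps)
  next
    case 2
    then have k: "k < n" "is_path n k l' j" using Cons.prems by auto
    \<comment> \<open>The path leaves state \<open>i\<close> here, so the whole stay value can be
      bounded by \<open>1\<close>.\<close>
    have "path_value f i C l \<preceq> 1 * (f y $$ (i, k) * path_value f k C' l')"
      using 2 nat_le_mult_right[OF stay_value_le_one[OF \<open>i < n\<close>]] by simp
    moreover have "f y $$ (i, k) * path_value f k C' l' \<preceq> f y $$ (i, k) * ?W w $$ (k, j)"
      by (intro nat_le_mult_left Cons.IH 2 k Cons.prems)
    ultimately show ?thesis
      using nat_le_trans nat_le_trans[OF _ le[OF k(1)]] by (simp del: word_value.simps) blast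
  qed
qed

text \<open>Upper bound for an entry: expanding the product gives a sum of path values, so it
  suffices to bound each term. The left factor \<open>p\<close> collects the matrix entries already
  expanded, as the induction requires.\<close>

lemma word_value_le:
  assumes "\<And>C l. in_lang C l w \<Longrightarrow> is_path n i l j \<Longrightarrow> p * path_value f i C l \<preceq> b"
    and "i < n" "j < n"
  shows "p * word_value (idem_diag_triangular_monoid n) f w $$ (i, j) \<preceq> b"
  using assms
proof (induction w arbitrary: i p)
  case Nil
  show ?case
  proof (cases "i = j")
    case True
    \<comment> \<open>The diagonal entry \<open>1\<close> is the value of the empty path with empty
      content.\<close>
    then show ?thesis using Nil.prems(1)[of "[]" "[]"] Nil.prems(2,3)
      by (simp add: idem_diag_triangular_monoid_def stay_value_def)
  next
    case False
    then show ?thesis using Nil.prems(2,3)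
      by (simp add: idem_diag_triangular_monoid_def nat_le_def)
  qed
next
  case (Cons y w)
  let ?W = "word_value (idem_diag_triangular_monoid n) f"
  have "p * f y $$ (i, k) * ?W w $$ (k, j) \<preceq> b" if "k < n" for k
  proof (cases "k < i")
    case True
    then show ?thesis using below_diag[of k i] Cons.prems(2) by (simp add: nat_le_def)
  next
    case False
    have "p * f y $$ (i, k) * path_value f k C l \<preceq> b" if C: "in_lang C l w" "is_path n k l j" for C l
    proof (cases "k = i")
      case True
      \<comment> \<open>Staying in state \<open>i\<close> puts \<open>y\<close> at the front of the
        first content, keeping the order of the factors.\<close>
      have "in_lang (y # C) l (y # w)" using in_lang_mono[OF C(1), of "y # C"] by auto
      from Cons.prems(1)[OF this] show ?thesis using C True
        by (simp add: path_value_Cons_content mult.assoc)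
    next
      case F: False
      \<comment> \<open>Moving up to \<open>k\<close> makes \<open>y\<close> a marked letter,
        preceded by an empty factor.\<close>
      have "in_lang [] ((y, k, C) # l) (y # w)" using C by simp
      from Cons.prems(1)[OF this] show ?thesis using C False F \<open>k < n\<close>
        by (simp add: stay_value_def mult.assoc)
    qed
    then show ?thesis using Cons.IH \<open>k < n\<close> \<open>j < n\<close> by blast
  qed
  then have "(\<Sum>k<n. p * f y $$ (i, k) * ?W w $$ (k, j)) \<preceq> b"
    by (intro sum_nat_le) simp
  then show ?case
    by (simp add: index_word_value_Cons f Cons.prems sum_distrib_left
        del: word_value.simps flip: mult.assoc)
qed

text \<open>Every path term of \<open>u\<close> belongs to a language that also contains
  \<open>v\<close>, so the lower bound for \<open>v\<close> serves as the bound \<open>b\<close> in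
  the upper estimate for \<open>u\<close>.\<close>

lemma word_value_entry_le:
  assumes "\<And>C l. in_lang C l u \<Longrightarrow> length l < n \<Longrightarrow> in_lang C l v"
    and "i < n" "j < n"
  shows "word_value (idem_diag_triangular_monoid n) f u $$ (i, j)
    \<preceq> word_value (idem_diag_triangular_monoid n) f v $$ (i, j)"
proof -
  have "1 * path_value f i C l \<preceq> word_value (idem_diag_triangular_monoid n) f v $$ (i, j)"
    if "in_lang C l u" "is_path n i l j" for C l
    using path_value_le_word_value[of C l v i j] assms that length_is_path[of n i l j] by simp
  from word_value_le[OF this assms(2,3)] show ?thesis by simp
qed

end

section \<open>Recognition by Boolean matrices\<close>

text \<open>Transition matrix of an automaton on states \<open>0\<close> to \<open>length l\<close>.
  With \<open>C\<close> prepended, position \<open>p\<close> holds the content looping at state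
  \<open>p\<close>, while \<open>l ! p\<close> holds the marked letter leading from \<open>p\<close>
  to \<open>Suc p\<close>.\<close>

definition lang_mat :: "nat \<Rightarrow> nat list \<Rightarrow> factor_path \<Rightarrow> nat \<Rightarrow> boolean mat" where
  "lang_mat n C l y = mat n n (\<lambda>(p, q).
     if (p = q \<and> p \<le> length l \<and> y \<in> set ((C # map (snd \<circ> snd) l) ! p)) \<or>
        (q = Suc p \<and> p < length l \<and> y = fst (l ! p))
     then 1 else 0)"

lemma index_lang_mat:
  assumes "p < n" "q < n"
  shows "lang_mat n C l y $$ (p, q) = 1 \<longleftrightarrow>
    (p = q \<and> p \<le> length l \<and> y \<in> set ((C # map (snd \<circ> snd) l) ! p)) \<or>
    (q = Suc p \<and> p < length l \<and> y = fst (l ! p))"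
  using assms by (simp add: lang_mat_def)

lemma lang_mat_carrier: "range (lang_mat n C l) \<subseteq> carrier (triangular_monoid n)"
  by (auto simp: lang_mat_def triangular_monoid_def)

lemma sum_boolean_eq_one_iff:
  fixes g :: "'b \<Rightarrow> boolean"
  assumes "finite A"
  shows "sum g A = 1 \<longleftrightarrow> (\<exists>k\<in>A. g k = 1)"
  using assms
proof (induction A)
  case (insert k A)
  have "a + b = 1 \<longleftrightarrow> a = 1 \<or> b = 1" for a b :: boolean
    by (cases a; cases b) (simp_all add: one_boolean_def)
  with insert show ?case by simp
qed simp

lemma mult_boolean_eq_one_iff: "a * b = 1 \<longleftrightarrow> a = 1 \<and> b = (1 :: boolean)"
  by (cases a; cases b) (simp_all add: one_boolean_def)

text \<open>In state \<open>r\<close> the first \<open>r\<close> marked letters have been consumed,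
  and \<open>length l\<close> is the accepting state. The induction needs every start state;
  recognition of the full language is the case \<open>r = 0\<close>.\<close>

lemma lang_mat_recognizes:
  assumes "r \<le> length l" "length l < n"
  shows "word_value (triangular_monoid n) (lang_mat n C l) w $$ (r, length l) = 1 \<longleftrightarrow>
    in_lang ((C # map (snd \<circ> snd) l) ! r) (drop r l) w"
  using assms(1)
proof (induction w arbitrary: r)
  case Nil
  then show ?case using assms by (auto simp: triangular_monoid_def)
next
  case (Cons y w)
  let ?W = "\<lambda>w r. word_value (triangular_monoid n) (lang_mat n C l) w $$ (r, length l)"
  let ?C = "\<lambda>r. (C # map (snd \<circ> snd) l) ! r"
  have f: "range (lang_mat n C l) \<subseteq> carrier (idem_diag_triangular_monoid n)"
    by (simp add: idem_diag_triangular_monoid_boolean lang_mat_carrier)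
  have "?W (y # w) r = 1 \<longleftrightarrow> (\<exists>k<n. lang_mat n C l y $$ (r, k) = 1 \<and> ?W w k = 1)"
    using index_word_value_Cons[OF f, of r "length l" y w] Cons.prems assms(2)
    by (auto simp: idem_diag_triangular_monoid_boolean sum_boolean_eq_one_iff
        mult_boolean_eq_one_iff simp del: word_value.simps)
  also have "\<dots> \<longleftrightarrow> (y \<in> set (?C r) \<and> ?W w r = 1) \<or>
      (r < length l \<and> y = fst (l ! r) \<and> ?W w (Suc r) = 1)"
    (is "?L \<longleftrightarrow> ?R")
  proof
    show "?L \<Longrightarrow> ?R" using Cons.prems assms(2) by (auto simp: index_lang_mat)
    assume ?R
    then show ?L
    proof
      assume "y \<in> set (?C r) \<and> ?W w r = 1"
      then have "lang_mat n C l y $$ (r, r) = 1 \<and> ?W w r = 1"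
        using Cons.prems assms(2) by (simp add: index_lang_mat)
      then show ?L using Cons.prems assms(2) by (meson le_less_trans)
    next
      assume "r < length l \<and> y = fst (l ! r) \<and> ?W w (Suc r) = 1"
      then have "Suc r < n" "lang_mat n C l y $$ (r, Suc r) = 1 \<and> ?W w (Suc r) = 1"
        using assms(2) by (simp_all add: index_lang_mat)
      then show ?L by blast
    qed
  qed
  also have "\<dots> \<longleftrightarrow> (y \<in> set (?C r) \<and> in_lang (?C r) (drop r l) w) \<or>
      (r < length l \<and> y = fst (l ! r) \<and> in_lang (?C (Suc r)) (drop (Suc r) l) w)"
    using Cons.IH[OF Cons.prems] Cons.IH[OF Suc_leI, of r] by blast
  also have "\<dots> \<longleftrightarrow> in_lang (?C r) (drop r l) (y # w)"
  proof (cases "r < length l")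
    case True
    then have "drop r l = l ! r # drop (Suc r) l" by (simp add: Cons_nth_drop_Suc)
    then show ?thesis using True by (cases "l ! r") auto
  qed auto
  finally show ?case .
qed

lemma in_lang_eq_if_boolean_identity:
  assumes "satisfies_identity (triangular_monoid n :: boolean mat monoid) u v"
    and "u \<noteq> []" "v \<noteq> []" "length l < n"
  shows "in_lang C l u \<longleftrightarrow> in_lang C l v"
proof -
  have "word_value (triangular_monoid n) (lang_mat n C l) u =
      word_value (triangular_monoid n) (lang_mat n C l) v"
    using assms(1) lang_mat_carrier
    unfolding satisfies_identity_iff_word_value[OF monoid_triangular_monoid assms(2,3)] by blast
  then show ?thesis
    using lang_mat_recognizes[of 0 l n C u] lang_mat_recognizes[of 0 l n C v] assms(4) by simp
qed

section \<open>Embedding the Boolean semiring\<close>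

definition of_boolean :: "boolean \<Rightarrow> 'a::semiring_1" where
  "of_boolean b = (if b = 1 then 1 else 0)"

text \<open>Additive idempotence turns \<open>1 + 1 = 1\<close> into an equation of the target, and
  injectivity comes from \<open>1 \<noteq> 0\<close>.\<close>

lemma inj_semiring_hom_of_boolean:
  "inj_semiring_hom (of_boolean :: boolean \<Rightarrow> 'a::comm_small_idem_semiring)"
proof
  fix a b :: boolean
  show "of_boolean (a + b) = (of_boolean a + of_boolean b :: 'a)"
    by (cases a; cases b) (simp_all add: of_boolean_def one_boolean_def add_idem)
  show "of_boolean (a * b) = (of_boolean a * of_boolean b :: 'a)"
    by (cases a; cases b) (simp_all add: of_boolean_def one_boolean_def)
  show "of_boolean a = (of_boolean b :: 'a) \<Longrightarrow> a = b"
    by (cases a; cases b) (simp_all add: of_boolean_def one_boolean_def)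
qed (simp_all add: of_boolean_def one_boolean_def zero_boolean_def)

lemma map_mat_of_boolean_word_value:
  fixes f :: "nat \<Rightarrow> boolean mat"
  assumes "range f \<subseteq> carrier (triangular_monoid n)"
  shows "map_mat of_boolean (word_value (triangular_monoid n) f w) =
    word_value (idem_diag_triangular_monoid n :: 'a::comm_small_idem_semiring mat monoid)
      (\<lambda>x. map_mat of_boolean (f x)) w"
proof -
  interpret inj_semiring_hom "of_boolean :: boolean \<Rightarrow> 'a"
    by (rule inj_semiring_hom_of_boolean)
  show ?thesis
  proof (induction w)
    case Nil
    show ?case by (simp add: triangular_monoid_def idem_diag_triangular_monoid_def mat_hom_one)
  next
    case (Cons x w)
    have "f x \<in> carrier_mat n n" "word_value (triangular_monoid n) f w \<in> carrier_mat n n"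
      using assms word_value_closed[OF monoid_triangular_monoid assms, of w]
      by (auto simp: triangular_monoid_def)
    from mat_hom_mult[OF this] Cons show ?case
      by (simp add: triangular_monoid_def idem_diag_triangular_monoid_def)
  qed
qed

lemma map_mat_of_boolean_carrier:
  assumes "A \<in> carrier (triangular_monoid n)"
  shows "map_mat of_boolean A \<in> carrier (idem_diag_triangular_monoid n)"
  using assms
  by (auto simp: triangular_monoid_def idem_diag_triangular_monoid_def of_boolean_def
      upper_triangular_def)

text \<open>The entrywise embedding is injective and multiplicative, so a Boolean substitution can
  be evaluated in the larger monoid and the equality pulled back.\<close>

lemma boolean_identity_if_identity:
  assumes "satisfies_identity
      (idem_diag_triangular_monoid n :: 'a::comm_small_idem_semiring mat monoid) u v"
    and "u \<noteq> []" "v \<noteq> []"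
  shows "satisfies_identity (triangular_monoid n :: boolean mat monoid) u v"
  unfolding satisfies_identity_iff_word_value[OF monoid_triangular_monoid assms(2,3)]
proof (intro allI impI)
  interpret inj_semiring_hom "of_boolean :: boolean \<Rightarrow> 'a"
    by (rule inj_semiring_hom_of_boolean)
  fix f :: "nat \<Rightarrow> boolean mat"
  assume f: "range f \<subseteq> carrier (triangular_monoid n)"
  have "range (\<lambda>x. map_mat of_boolean (f x) :: 'a mat) \<subseteq> carrier (idem_diag_triangular_monoid n)"
    using f map_mat_of_boolean_carrier by blast
  then have "map_mat (of_boolean :: boolean \<Rightarrow> 'a) (word_value (triangular_monoid n) f u) =
      map_mat of_boolean (word_value (triangular_monoid n) f v)"
    using assms(1) unfolding map_mat_of_boolean_word_value[OF f]
      satisfies_identity_iff_word_value[OF monoid_idem_diag_triangular_monoid assms(2,3)]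
    by blast
  then show "word_value (triangular_monoid n) f u = word_value (triangular_monoid n) f v"
    by (rule mat_hom_inj)
qed

lemma identity_if_boolean_identity:
  assumes id: "satisfies_identity (triangular_monoid n :: boolean mat monoid) u v"
    and uv: "u \<noteq> []" "v \<noteq> []"
  shows "satisfies_identity
      (idem_diag_triangular_monoid n :: 'a::comm_small_idem_semiring mat monoid) u v"
  unfolding satisfies_identity_iff_word_value[OF monoid_idem_diag_triangular_monoid uv]
proof (intro allI impI)
  fix f :: "nat \<Rightarrow> 'a mat"
  assume f: "range f \<subseteq> carrier (idem_diag_triangular_monoid n)"
  let ?W = "word_value (idem_diag_triangular_monoid n) f"
  note lang = in_lang_eq_if_boolean_identity[OF id uv]
  \<comment> \<open>Both words lie in the same languages with fewer than \<open>n\<close> marked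
    letters, so each entry is below the other.\<close>
  have "?W u $$ (i, j) = ?W v $$ (i, j)" if "i < n" "j < n" for i j
    using word_value_entry_le[OF f, of u v i j] word_value_entry_le[OF f, of v u i j] lang that
    by (blast intro: nat_le_antisym)
  moreover have "?W w \<in> carrier_mat n n" for w
    using word_value_closed[OF monoid_idem_diag_triangular_monoid f]
    by (auto simp: idem_diag_triangular_monoid_def)
  ultimately show "?W u = ?W v" by (metis carrier_matD eq_matI)
qed

theorem theorem2p29:
  fixes n :: nat
  assumes "n \<ge> 2"
  shows "equationally_equivalent
    (idem_diag_triangular_monoid n :: 'a::comm_small_idem_semiring mat monoid)
    (triangular_monoid n :: boolean mat monoid)"
  by (auto simp: equationally_equivalent_def free_words_def
      intro: boolean_identity_if_identity identity_if_boolean_identity)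

end
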